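(* For every integer $m \geq 1$, the following identities of formal power series in $t$ with coefficients in $\mathbb{V}$ hold: $$\tilde{G}(-q^{m-1}t) \star \tilde{G}(-q^{m-3}t) \star \cdots \star \tilde{G}(-q^{1-m}t)=\exp\left(-\sum_{n=1}^\infty \frac{[mn]_q}{n}\,xC_{n-1}y\,t^n\right),$$ $$D(-q^{m-1}t) \star D(-q^{m-3}t) \star \cdots \star D(-q^{1-m}t)=\exp\left(\sum_{n=1}^\infty \frac{[mn]_q}{n}\,xC_{n-1}y\,t^n\right).$$ Here the exponential power series is computed with respect to the $q$-shuffle product $\star$.
   Context: Let $\mathbb{F}$ be a field of characteristic zero and let $q \in \mathbb{F}$ be nonzero and not a root of unity. $\mathbb{N}=\{0,1,2,\ldots\}$. For $n \in \mathbb{Z}$, $[n]_q=\frac{q^n-q^{-n}}{q-q^{-1}}$. $\mathbb{V}$ is the free associative unital $\mathbb{F}$-algebra on noncommuting letters $x,y$; the words (products of letters, including the empty word $\mathbf{1}$) form a basis, and juxtaposition denotes the free product. The $q$-shuffle product $\star$ is the associative bilinear product on $\mathbb{V}$ determined by $\mathbf{1}\star v=v\star\mathbf{1}=v$ and, for nonempty words $u=u_1\cdots u_r$, $v=v_1\cdots v_s$, $$u \star v=u_1((u_2 \cdots u_r) \star v)+v_1(u \star (v_2 \cdots v_s))\,q^{\langle v_1,u_1 \rangle+\cdots+\langle v_1,u_r \rangle},$$ where $\langle x,x\rangle=\langle y,y\rangle=2$ and $\langle x,y\rangle=\langle y,x\rangle=-2$. It extends to formal power series in the (central) indeterminate $t$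 with coefficients in $\mathbb{V}$. Set $\overline{x}=1$, $\overline{y}=-1$. A word $a_1\cdots a_n$ is Catalan if $\overline{a}_1+\cdots+\overline{a}_i\geq 0$ for $1\leq i\leq n-1$ and $\overline{a}_1+\cdots+\overline{a}_n=0$ (the empty word is Catalan; Catalan words have even length). For $n\in\mathbb{N}$, $C_n=\sum a_1a_2\cdots a_{2n}\prod_{i=1}^{2n}[1+\overline{a}_1+\overline{a}_2+\cdots+\overline{a}_i]_q$, the sum being over all Catalan words of length $2n$ (so $C_0=\mathbf{1}$). The element $xC_{n-1}y$ is formed with the free product. $\tilde{G}_n=(xy)^n$ (free-product power, $\tilde{G}_0=\mathbf{1}$), $\tilde{G}(t)=\sum_{n\in\mathbb{N}}\tilde{G}_nt^n$, and $D(t)=\sum_{n\in\mathbb{N}}D_nt^n$ is the multiplicative inverse of $\tilde{G}(t)$ with respect to $\star$: $\tilde{G}(t)\star D(t)=\mathbf{1}=D(t)\star\tilde{G}(t)$. $\exp(z)=\sum_{n\in\mathbb{N}} z^n/n!$. *)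

theory Defs
  imports "HOL-Computational_Algebra.Computational_Algebra" "HOL-Library.Poly_Mapping"
begin

datatype letter = X | Y

text \<open>
  Lists form the free monoid under concatenation. With this instance the type
  \<^typ>\<open>letter list \<Rightarrow>\<^sub>0 'a\<close> is the monoid algebra of the free monoid on \<^const>\<open>X\<close>, \<^const>\<open>Y\<close>, so its
  ring multiplication \<open>*\<close> is the free product and its unit is the empty word.
\<close>

instantiation list :: (type) monoid_add
begin

definition zero_list :: "'a list" where "zero_list = []"

definition plus_list :: "'a list \<Rightarrow> 'a list \<Rightarrow> 'a list" where "plus_list u v = u @ v"

instance by standard (simp_all add: zero_list_def plus_list_def)

end

type_synonym 'a free_alg = "letter list \<Rightarrow>\<^sub>0 'a"

abbreviation word :: "letter list \<Rightarrow> 'a::field free_alg" where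
  "word w \<equiv> Poly_Mapping.single w 1"

definition smul :: "'a::field \<Rightarrow> 'a free_alg \<Rightarrow> 'a free_alg" where
  "smul c v = Poly_Mapping.map ((*) c) v"

definition qint :: "'a::field \<Rightarrow> int \<Rightarrow> 'a" where
  "qint q n = (q powi n - q powi (- n)) / (q - inverse q)"


subsection \<open>The q-shuffle product\<close>

definition pairing :: "letter \<Rightarrow> letter \<Rightarrow> int" where
  "pairing a b = (if a = b then 2 else - 2)"

fun word_shuffle :: "'a::field \<Rightarrow> letter list \<Rightarrow> letter list \<Rightarrow> 'a free_alg" where
  "word_shuffle q [] v = word v"
| "word_shuffle q u [] = word u"
| "word_shuffle q (a # u) (b # v) =
     word [a] * word_shuffle q u (b # v) +
     smul (q powi (\<Sum>c\<leftarrow>a # u. pairing b c)) (word [b] * word_shuffle q (a # u) v)"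

definition shuffle :: "'a::field \<Rightarrow> 'a free_alg \<Rightarrow> 'a free_alg \<Rightarrow> 'a free_alg" where
  "shuffle q f g = (\<Sum>u\<in>Poly_Mapping.keys f. \<Sum>v\<in>Poly_Mapping.keys g.
     smul (Poly_Mapping.lookup f u * Poly_Mapping.lookup g v) (word_shuffle q u v))"


subsection \<open>Power series in a central indeterminate\<close>

text \<open>
  Only the additive structure and the unit of the type \<open>fps\<close> are used below, together with its
  metric (the usual \<open>t\<close>-adic one); its ring multiplication comes from the free product.
\<close>

definition fps_shuffle ::
    "'a::field \<Rightarrow> 'a free_alg fps \<Rightarrow> 'a free_alg fps \<Rightarrow> 'a free_alg fps" where
  "fps_shuffle q f g = Abs_fps (\<lambda>n. \<Sum>i\<le>n. shuffle q (fps_nth f i) (fps_nth g (n - i)))"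

definition fps_smul :: "'a::field \<Rightarrow> 'a free_alg fps \<Rightarrow> 'a free_alg fps" where
  "fps_smul c f = Abs_fps (\<lambda>n. smul c (fps_nth f n))"

text \<open>The substitution of \<open>c t\<close> for \<open>t\<close>.\<close>

definition fps_dilate :: "'a::field \<Rightarrow> 'a free_alg fps \<Rightarrow> 'a free_alg fps" where
  "fps_dilate c f = Abs_fps (\<lambda>n. smul (c ^ n) (fps_nth f n))"

definition fps_shuffle_prod :: "'a::field \<Rightarrow> 'a free_alg fps list \<Rightarrow> 'a free_alg fps" where
  "fps_shuffle_prod q fs = foldr (fps_shuffle q) fs 1"

definition fps_shuffle_power :: "'a::field \<Rightarrow> 'a free_alg fps \<Rightarrow> nat \<Rightarrow> 'a free_alg fps" where
  "fps_shuffle_power q f k = fps_shuffle_prod q (replicate k f)"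

definition fps_shuffle_inverse :: "'a::field \<Rightarrow> 'a free_alg fps \<Rightarrow> 'a free_alg fps" where
  "fps_shuffle_inverse q f = (THE g. fps_shuffle q f g = 1 \<and> fps_shuffle q g f = 1)"

text \<open>The sum converges \<open>t\<close>-adically if \<open>f\<close> has no constant term; see the lemmas below.\<close>

definition fps_shuffle_exp :: "'a::field_char_0 \<Rightarrow> 'a free_alg fps \<Rightarrow> 'a free_alg fps" where
  "fps_shuffle_exp q f = suminf (\<lambda>k. fps_smul (1 / fact k) (fps_shuffle_power q f k))"

lemma shuffle_zero_left [simp]: "shuffle q 0 g = 0"
  and shuffle_zero_right [simp]: "shuffle q f 0 = 0"
  by (simp_all add: shuffle_def)

lemma smul_zero_right [simp]: "smul c 0 = 0"
  by (simp add: smul_def mult_map_scale_conv_mult)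

lemma fps_shuffle_power_nth_eq_0:
  assumes "fps_nth f 0 = 0" "n < k"
  shows "fps_nth (fps_shuffle_power q f k) n = 0"
  using assms(2)
proof (induction k arbitrary: n)
  case (Suc k)
  have "shuffle q (fps_nth f i) (fps_nth (fps_shuffle_power q f k) (n - i)) = 0" if "i \<le> n" for i
  proof (cases "i = 0")
    case False
    then have "n - i < k" using Suc.prems that by linarith
    then show ?thesis using Suc.IH by simp
  qed (simp add: assms(1))
  moreover have "fps_shuffle_power q f (Suc k) = fps_shuffle q f (fps_shuffle_power q f k)"
    by (simp add: fps_shuffle_power_def fps_shuffle_prod_def)
  ultimately show ?case by (simp add: fps_shuffle_def)
qed simp

lemma fps_shuffle_exp_sums:
  assumes "fps_nth f 0 = 0"
  shows "(\<lambda>k. fps_smul (1 / fact k) (fps_shuffle_power q f k)) sums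
    Abs_fps (\<lambda>n. \<Sum>k\<le>n. smul (1 / fact k) (fps_nth (fps_shuffle_power q f k) n))"
    (is "?F sums ?L")
  unfolding sums_def
proof (rule tendsto_fpsI)
  fix n
  have "fps_nth (\<Sum>k<N. ?F k) n = fps_nth ?L n" if "N > n" for N
  proof -
    have "(\<Sum>k<N. fps_nth (?F k) n) = (\<Sum>k\<le>n. fps_nth (?F k) n)"
      using that assms
      by (intro sum.mono_neutral_right) (auto simp: fps_smul_def fps_shuffle_power_nth_eq_0)
    then show ?thesis by (simp add: fps_sum_nth fps_smul_def)
  qed
  then show "\<forall>\<^sub>F N in sequentially. fps_nth (\<Sum>k<N. ?F k) n = fps_nth ?L n"
    by (auto simp: eventually_sequentially intro: exI[of _ "Suc n"])
qed

lemma fps_shuffle_exp_nth: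
  assumes "fps_nth f 0 = 0"
  shows "fps_nth (fps_shuffle_exp q f) n =
    (\<Sum>k\<le>n. smul (1 / fact k) (fps_nth (fps_shuffle_power q f k) n))"
  by (simp add: fps_shuffle_exp_def flip: sums_unique[OF fps_shuffle_exp_sums[OF assms, of q]])


subsection \<open>Catalan words\<close>

fun letter_weight :: "letter \<Rightarrow> int" where
  "letter_weight X = 1"
| "letter_weight Y = - 1"

definition word_weight :: "letter list \<Rightarrow> int" where
  "word_weight w = (\<Sum>a\<leftarrow>w. letter_weight a)"

definition catalan :: "letter list \<Rightarrow> bool" where
  "catalan w \<longleftrightarrow> (\<forall>i. 1 \<le> i \<and> i < length w \<longrightarrow> word_weight (take i w) \<ge> 0) \<and> word_weight w = 0"

lemma finite_words_of_length: "finite {w :: letter list. P w \<and> length w = n}"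
proof -
  have "finite {w :: letter list. set w \<subseteq> {X, Y} \<and> length w = n}"
    by (rule finite_lists_length_eq) simp
  moreover have "set w \<subseteq> {X, Y}" for w using letter.exhaust by blast
  ultimately show ?thesis by (auto elim: rev_finite_subset)
qed

definition catalan_elt :: "'a::field \<Rightarrow> nat \<Rightarrow> 'a free_alg" where
  "catalan_elt q n = (\<Sum>w | catalan w \<and> length w = 2 * n.
     smul (\<Prod>i = 1..2 * n. qint q (1 + word_weight (take i w))) (word w))"

definition Gt :: "'a::field free_alg fps" where
  "Gt = Abs_fps (\<lambda>n. word [X, Y] ^ n)"

definition Dt :: "'a::field \<Rightarrow> 'a free_alg fps" where
  "Dt q = fps_shuffle_inverse q Gt"

text \<open>The series \<open>\<Sum>n\<ge>1. [m n]\<^sub>q / n x C\<^bsub>n-1\<^esub> y t\<^sup>n\<close>.\<close>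

definition catalan_log :: "'a::field_char_0 \<Rightarrow> nat \<Rightarrow> 'a free_alg fps" where
  "catalan_log q m = Abs_fps (\<lambda>n. if n = 0 then 0 else
     smul (qint q (int (m * n)) / of_nat n) (word [X] * catalan_elt q (n - 1) * word [Y]))"

end

(*
  Deleting the first letter of a word is a twisted derivation of the q-shuffle product, so an identity
  between shuffle expressions can be proved by deleting letters until it closes up.  Let c(n) = x C(n-1) y,
  and let E(h) be the generating function of the lattice paths from height h to 0, each weighted by the
  product of the q-integers of its heights, so that c = x E(1).  In this way one finds closed relations
  for E(h) * Gt(-t) at the arguments t/q and qt, and for h = 1 they combine to the differential equation
    t d/dt Gt(-t) = - (sum over n of [n] c(n) t^n) * Gt(-t).
  The (xy)^n commute with each other by the same method; since [n] is nonzero, the equation expresses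
  c(n) through them, so all c(n) and (xy)^n commute.  Hence both sides of the theorem are solutions of
  one first-order linear differential equation with constant term 1, because the sum of [n] q^(n(m-1-2i))
  over i < m is [mn].
*)

theory Submission
  imports Defs
begin

section \<open>Weights of words and the pairing of letters\<close>

abbreviation "coef \<equiv> Poly_Mapping.lookup"

definition pair_sum :: "letter \<Rightarrow> letter list \<Rightarrow> int" where
  "pair_sum a u = (\<Sum>c\<leftarrow>u. pairing a c)"

text \<open>Each letter pairs with \<open>X\<close> to twice its weight and with \<open>Y\<close> to
  the negative of that. Hence the twist in the shuffle product sees only the weight of a
  word.\<close>

lemma pair_sum_X: "pair_sum X u = 2 * word_weight u"
  and pair_sum_Y: "pair_sum Y u = - 2 * word_weight u"
proof -
  have "pair_sum X u = 2 * word_weight u \<and> pair_sum Y u = - 2 * word_weight u"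
  proof (induction u)
    case (Cons a u)
    then show ?case by (cases a) (auto simp: pair_sum_def word_weight_def pairing_def)
  qed (simp_all add: pair_sum_def word_weight_def)
  then show "pair_sum X u = 2 * word_weight u" "pair_sum Y u = - 2 * word_weight u" by auto
qed

lemma pair_sum_Nil [simp]: "pair_sum a [] = 0"
  and pair_sum_Cons [simp]: "pair_sum a (c # u) = pairing a c + pair_sum a u"
  by (simp_all add: pair_sum_def)

lemma word_weight_Nil [simp]: "word_weight [] = 0"
  and word_weight_Cons [simp]: "word_weight (a # u) = letter_weight a + word_weight u"
  and word_weight_append [simp]: "word_weight (u @ v) = word_weight u + word_weight v"
  by (simp_all add: word_weight_def)

section \<open>The q-shuffle product on functions of words\<close>

text \<open>
  The shuffle product of formal sums of words, determined by the rule that deletion of an initial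
  letter is a twisted derivation; \<open>p n\<close> plays the role of \<open>q\<^sup>n\<close>.
\<close>

fun word_fun_shuffle ::
    "(int \<Rightarrow> 'b::comm_ring_1) \<Rightarrow> (letter list \<Rightarrow> 'b) \<Rightarrow> (letter list \<Rightarrow> 'b) \<Rightarrow> letter list \<Rightarrow> 'b" where
  "word_fun_shuffle p f g [] = f [] * g []"
| "word_fun_shuffle p f g (a # w) = word_fun_shuffle p (\<lambda>u. f (a # u)) g w +
     word_fun_shuffle p (\<lambda>u. p (pair_sum a u) * f u) (\<lambda>u. g (a # u)) w"

text \<open>On such a function the twist \<open>p (pair_sum a u)\<close> acts as one fixed
  scalar.\<close>

definition homogeneous :: "int \<Rightarrow> (letter list \<Rightarrow> 'b::zero) \<Rightarrow> bool" where
  "homogeneous d f \<longleftrightarrow> (\<forall>u. f u \<noteq> 0 \<longrightarrow> word_weight u = d)"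

text \<open>Two models are used: the powers of q in the field, and the same powers as constant power
  series in t. Results thus hold for single elements and for generating functions.\<close>

locale quantum_powers =
  fixes p :: "int \<Rightarrow> 'b::comm_ring_1"
  assumes p_add: "p (m + n) = p m * p n" and p_0 [simp]: "p 0 = 1"
begin

abbreviation sh (infixl "\<star>" 70) where "f \<star> g \<equiv> word_fun_shuffle p f g"

lemma sh_add_left: "((\<lambda>u. f u + g u) \<star> h) w = (f \<star> h) w + (g \<star> h) w"
proof (induction w arbitrary: f g h)
  case (Cons a w)
  show ?case by (simp add: distrib_left Cons.IH)
qed (simp add: distrib_right)

lemma sh_add_right: "(f \<star> (\<lambda>u. g u + h u)) w = (f \<star> g) w + (f \<star> h) w"
proof (induction w arbitrary: f g h)
  case (Cons a w)
  show ?case by (simp add: Cons.IH)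
qed (simp add: distrib_left)

lemma sh_scale_left: "((\<lambda>u. c * f u) \<star> g) w = c * (f \<star> g) w"
proof (induction w arbitrary: f g)
  case (Cons a w)
  have "(\<lambda>u. p (pair_sum a u) * (c * f u)) = (\<lambda>u. c * (p (pair_sum a u) * f u))"
    by (simp add: mult.left_commute)
  then show ?case by (simp add: distrib_left Cons.IH)
qed simp

lemma sh_scale_right: "(f \<star> (\<lambda>u. c * g u)) w = c * (f \<star> g) w"
proof (induction w arbitrary: f g)
  case (Cons a w)
  show ?case by (simp add: distrib_left Cons.IH)
qed simp

lemma sh_zero_left [simp]: "((\<lambda>u. 0) \<star> g) w = 0"
  and sh_zero_right [simp]: "(f \<star> (\<lambda>u. 0)) w = 0"
  using sh_scale_left[of 0 f g w] sh_scale_right[of f 0 g w] sh_scale_left[of 0 "\<lambda>u. 0" g w]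
  by simp_all

lemma sh_minus_right: "(f \<star> (\<lambda>u. - g u)) w = - (f \<star> g) w"
  using sh_scale_right[of f "-1" g w] by simp

lemma sh_sum_left: "((\<lambda>u. \<Sum>i\<in>A. f i u) \<star> g) w = (\<Sum>i\<in>A. (f i \<star> g) w)"
  by (induction A rule: infinite_finite_induct) (simp_all add: sh_add_left)

lemma sh_sum_right: "(f \<star> (\<lambda>u. \<Sum>i\<in>A. g i u)) w = (\<Sum>i\<in>A. (f \<star> g i) w)"
  by (induction A rule: infinite_finite_induct) (simp_all add: sh_add_right)

lemma sh_unit_left [simp]: "((\<lambda>u. if u = [] then 1 else 0) \<star> g) w = g w"
proof (induction w arbitrary: g)
  case (Cons a w)
  have "(\<lambda>u. p (pair_sum a u) * (if u = [] then 1 else 0)) = (\<lambda>u. if u = [] then 1 else 0)"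
    by auto
  then show ?case by (simp add: Cons.IH cong: if_cong)
qed simp

lemma sh_unit_right [simp]: "(f \<star> (\<lambda>u. if u = [] then 1 else 0)) w = f w"
  by (induction w arbitrary: f) simp_all

text \<open>The twist is multiplicative because \<open>pair_sum a\<close> is additive over letters
  and a word in a shuffle has exactly the letters of its two factors.\<close>

lemma twist_sh:
  "p (pair_sum a w) * (f \<star> g) w =
     ((\<lambda>u. p (pair_sum a u) * f u) \<star> (\<lambda>u. p (pair_sum a u) * g u)) w"
proof (induction w arbitrary: f g)
  case (Cons b w)
  have "(\<lambda>u. p (pair_sum a (b # u)) * h u) = (\<lambda>u. p (pairing a b) * (p (pair_sum a u) * h u))" for h
    by (simp add: p_add mult.assoc)
  moreover have "(\<lambda>u. p (pair_sum b u) * (p (pair_sum a u) * f u)) =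
      (\<lambda>u. p (pair_sum a u) * (p (pair_sum b u) * f u))"
    by (simp add: mult.left_commute)
  ultimately show ?case
    by (simp add: sh_scale_left sh_scale_right p_add distrib_left mult.assoc flip: Cons.IH)
qed simp

text \<open>Deleting a letter from either bracketing leaves three terms, in which the letter comes
  from \<open>f\<close>, \<open>g\<close> or \<open>h\<close>; \<open>twist_sh\<close> distributes
  the twist of \<open>f \<star> g\<close> over its factors, so that they agree.\<close>

lemma sh_assoc: "((f \<star> g) \<star> h) w = (f \<star> (g \<star> h)) w"
proof (induction w arbitrary: f g h)
  case (Cons a w)
  show ?case
    by (simp add: twist_sh sh_add_left sh_add_right Cons.IH)
qed (simp add: mult.assoc)

lemma sh_X:
  assumes "homogeneous d f"
  shows "(f \<star> g) (X # w) = ((\<lambda>u. f (X # u)) \<star> g) w + p (2 * d) * (f \<star> (\<lambda>u. g (X # u))) w"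
proof -
  have "(\<lambda>u. p (pair_sum X u) * f u) = (\<lambda>u. p (2 * d) * f u)"
  proof
    show "p (pair_sum X u) * f u = p (2 * d) * f u" for u
      using assms by (cases "f u = 0") (auto simp: homogeneous_def pair_sum_X)
  qed
  then show ?thesis by (simp add: sh_scale_left)
qed

lemma sh_Y:
  assumes "homogeneous d f"
  shows "(f \<star> g) (Y # w) = ((\<lambda>u. f (Y # u)) \<star> g) w + p (- 2 * d) * (f \<star> (\<lambda>u. g (Y # u))) w"
proof -
  have "(\<lambda>u. p (pair_sum Y u) * f u) = (\<lambda>u. p (- 2 * d) * f u)"
  proof
    show "p (pair_sum Y u) * f u = p (- 2 * d) * f u" for u
      using assms by (cases "f u = 0") (auto simp: homogeneous_def pair_sum_Y)
  qed
  then show ?thesis by (simp add: sh_scale_left)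
qed

end

section \<open>Coefficients of the q-shuffle product\<close>

lemma lookup_smul [simp]: "coef (smul c f) w = c * coef f w"
  by (simp add: smul_def Poly_Mapping.map.rep_eq when_def)

lemma lookup_word_mult_Cons: "coef (word [a] * f) (b # w) = (if a = b then coef f w else 0)"
  and lookup_word_mult_Nil: "coef (word [a] * f) [] = 0"
proof -
  have "coef (word [a] * f) (b # w) = (if a = b then coef f w else 0)
      \<and> coef (word [a] * f) [] = 0"
    for a b w
  proof (induction f rule: update_induct)
    case (update f v c)
    have "Poly_Mapping.update v c f = Poly_Mapping.single v c + f"
      using update.hyps
      by (intro poly_mapping_eqI) (auto simp: lookup_update lookup_add lookup_single in_keys_iff when_def)
    moreover have "word [a] * Poly_Mapping.single v c = Poly_Mapping.single (a # v) c"
      by (simp add: mult_single plus_list_def)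
    ultimately show ?case using update.IH
      by (simp add: distrib_left lookup_add lookup_single when_def)
  qed simp
  then show "coef (word [a] * f) (b # w) = (if a = b then coef f w else 0)"
    "coef (word [a] * f) [] = 0" by auto
qed

lemma quantum_powers_powi: "q \<noteq> 0 \<Longrightarrow> quantum_powers (\<lambda>n. (q::'a::field) powi n)"
  by standard (simp_all add: power_int_add)

text \<open>\<open>word_shuffle\<close> recurses on the first letters of its factors,
  \<open>word_fun_shuffle\<close> on the first letter of the result. They agree because that letter
  comes from one of the two factors, with the same twist.\<close>

lemma lookup_word_shuffle:
  fixes q :: "'a::field"
  assumes "q \<noteq> 0"
  shows "coef (word_shuffle q u v) w =
    word_fun_shuffle (\<lambda>n. q powi n) (\<lambda>z. if z = u then 1 else 0) (\<lambda>z. if z = v then 1 else 0) w"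
  using assms
proof (induction q u v arbitrary: w rule: word_shuffle.induct)
  case (1 q v)
  then interpret quantum_powers "\<lambda>n. q powi n" by (rule quantum_powers_powi)
  show ?case by (simp add: lookup_single when_def eq_commute)
next
  case (2 q a u)
  then interpret quantum_powers "\<lambda>n. q powi n" by (intro quantum_powers_powi)
  show ?case by (simp add: lookup_single when_def eq_commute)
next
  case (3 q a u b v)
  then interpret quantum_powers "\<lambda>n. q powi n" by (intro quantum_powers_powi)
  show ?case
  proof (cases w)
    case Nil
    then show ?thesis by (simp add: lookup_add lookup_word_mult_Nil)
  next
    case (Cons c w')
    \<comment> \<open>The twist of an indicator function is a scalar multiple of it, which can be
      taken out of the product.\<close>
    have *: "(\<lambda>z. q powi pair_sum c z * (if z = a # u then 1 else 0)) =
        (\<lambda>z. q powi pair_sum c (a # u) * (if z = a # u then 1 else 0))" by auto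
    have **: "(\<lambda>z. if c # z = d # u' then 1 else 0) =
        (\<lambda>z. (if c = d then 1 else 0) * (if z = u' then 1 else 0 :: 'a))" for d u' by auto
    show ?thesis unfolding Cons word_fun_shuffle.simps * ** sh_scale_left sh_scale_right
      using 3 by (auto simp: lookup_add lookup_word_mult_Cons pair_sum_def)
  qed
qed

lemma lookup_shuffle:
  fixes q :: "'a::field"
  assumes "q \<noteq> 0"
  shows "coef (shuffle q f g) w = word_fun_shuffle (\<lambda>n. q powi n) (coef f) (coef g) w"
proof -
  interpret quantum_powers "\<lambda>n. q powi n"
    by (rule quantum_powers_powi) fact
  have *: "coef h = (\<lambda>z. \<Sum>u\<in>Poly_Mapping.keys h. coef h u * (if z = u then 1 else 0))" for h :: "'a free_alg"
    by (rule ext) (auto simp: in_keys_iff if_distrib cong: if_cong)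
  show ?thesis
    unfolding arg_cong2[where f = "\<lambda>x y. sh x y w", OF *[of f] *[of g]]
      sh_sum_left sh_sum_right sh_scale_left sh_scale_right
      lookup_word_shuffle[OF assms, symmetric]
    by (simp add: shuffle_def lookup_sum mult.assoc sum_distrib_left)
qed

section \<open>Lattice paths and alternating words\<close>

text \<open>
  Words are read as lattice paths (\<^const>\<open>X\<close> goes up, \<^const>\<open>Y\<close> down) from height \<open>h\<close> to \<open>0\<close>.  A path
  has weight \<open>br k\<close> for every height \<open>k\<close> from which it takes a step and \<open>t\<close> for every \<^const>\<open>Y\<close>; since \<open>br 0 = 0\<close>,
  paths that meet \<open>0\<close> before their end do not count.
\<close>

fun path_sum :: "(int \<Rightarrow> 'b::comm_ring_1) \<Rightarrow> 'b \<Rightarrow> int \<Rightarrow> letter list \<Rightarrow> 'b" where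
  "path_sum br t h [] = (if h = 0 then 1 else 0)"
| "path_sum br t h (X # w) = br h * path_sum br t (h + 1) w"
| "path_sum br t h (Y # w) = br h * t * path_sum br t (h - 1) w"

text \<open>With \<open>br\<close> the q-integers this is the generating function of
  \<open>x C(n-1) y t^n\<close>: the path from height 1 to 0 holds the Catalan word and the final y,
  whose step has factor [1] = 1.\<close>

fun catalan_path :: "(int \<Rightarrow> 'b::comm_ring_1) \<Rightarrow> 'b \<Rightarrow> letter list \<Rightarrow> 'b" where
  "catalan_path br t [] = 0"
| "catalan_path br t (X # w) = path_sum br t 1 w"
| "catalan_path br t (Y # w) = 0"

text \<open>With \<^const>\<open>X\<close> this is \<open>\<Sum>n. (xy)\<^sup>n (-t)\<^sup>n\<close>, with \<^const>\<open>Y\<close> its image under deletion of an initial \<^const>\<open>X\<close>.\<close>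

fun alternating :: "'b::comm_ring_1 \<Rightarrow> letter \<Rightarrow> letter list \<Rightarrow> 'b" where
  "alternating t X [] = 1"
| "alternating t Y [] = 0"
| "alternating t X (X # w) = alternating t Y w"
| "alternating t X (Y # w) = 0"
| "alternating t Y (X # w) = 0"
| "alternating t Y (Y # w) = - t * alternating t X w"

lemma homogeneous_path_sum: "homogeneous (- h) (path_sum br t h)"
proof -
  have "path_sum br t h u \<noteq> 0 \<Longrightarrow> h = - word_weight u" for u
    by (induction br t h u rule: path_sum.induct) (force split: if_splits)+
  then show ?thesis unfolding homogeneous_def by force
qed

lemma homogeneous_catalan_path: "homogeneous 0 (catalan_path br t)"
proof -
  have "catalan_path br t u \<noteq> 0 \<Longrightarrow> word_weight u = 0" for u
    using homogeneous_path_sum[of 1 br t]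
    by (induction br t u rule: catalan_path.induct) (auto simp: homogeneous_def)
  then show ?thesis unfolding homogeneous_def by force
qed

text \<open>Two recurrences for [h] replace its definition as a quotient, so that they also make
  sense for constant power series.\<close>

locale quantum_integers = quantum_powers p for p :: "int \<Rightarrow> 'b::idom" +
  fixes br :: "int \<Rightarrow> 'b"
  assumes br_0 [simp]: "br 0 = 0"
    and br_Suc: "br (h + 1) = p 1 * br h + p (- h)"
    and br_Suc': "br (h + 1) = p (- 1) * br h + p h"
begin

lemma br_1 [simp]: "br 1 = 1"
  using br_Suc[of 0] by simp

lemma path_sum_0: "path_sum br t 0 = (\<lambda>u. if u = [] then 1 else 0)"
proof
  show "path_sum br t 0 u = (if u = [] then 1 else 0)" for u
    by (cases "(br, t, 0::int, u)" rule: path_sum.cases) auto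
qed

text \<open>Only the path factor has its argument \<open>t\<close> rescaled, by \<open>a\<close>;
  the relations below take \<open>a\<close> to be \<open>p 1\<close> or \<open>p (- 1)\<close>, that
  is, q or 1/q.\<close>

definition paths_X :: "'b \<Rightarrow> 'b \<Rightarrow> int \<Rightarrow> letter list \<Rightarrow> 'b" where
  "paths_X t a h = path_sum br (a * t) h \<star> alternating t X"

definition paths_Y :: "'b \<Rightarrow> 'b \<Rightarrow> int \<Rightarrow> letter list \<Rightarrow> 'b" where
  "paths_Y t a h = path_sum br (a * t) h \<star> alternating t Y"

text \<open>The paths from height \<open>h\<close> have degree \<open>- h\<close>, whence the powers
  \<open>p (- 2 * h)\<close> and \<open>p (2 * h)\<close>. Only the heights \<open>h - 1\<close>,
  \<open>h\<close> and \<open>h + 1\<close> occur, which makes relations stated for all heights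
  accessible to induction on the word.\<close>

lemma paths_X_Cons:
  "paths_X t a h (X # w) = br h * paths_X t a (h + 1) w + p (- 2 * h) * paths_Y t a h w"
  "paths_X t a h (Y # w) = br h * (a * t) * paths_X t a (h - 1) w"
  and paths_Y_Cons:
  "paths_Y t a h (X # w) = br h * paths_Y t a (h + 1) w"
  "paths_Y t a h (Y # w) = br h * (a * t) * paths_Y t a (h - 1) w - p (2 * h) * t * paths_X t a h w"
  unfolding paths_X_def paths_Y_def
  by (simp_all add: sh_X[OF homogeneous_path_sum] sh_Y[OF homogeneous_path_sum]
      sh_scale_left sh_scale_right sh_minus_right mult.assoc del: word_fun_shuffle.simps)

lemma paths_X_Nil: "paths_X t a h [] = (if h = 0 then 1 else 0)"
  and paths_Y_Nil: "paths_Y t a h [] = 0"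
  unfolding paths_X_def paths_Y_def by simp_all

lemma paths_X_0: "paths_X t a 0 = alternating t X"
  unfolding paths_X_def path_sum_0 by auto

lemma p_simps:
  "p (- h - 1) = p (- h) * p (- 1)" "p (- h - 2) = p (- h) * p (- 1) * p (- 1)"
  "p (- 2 * h) = p (- h) * p (- h)" "p (2 * h) = p h * p h"
  "p (- (h + 1)) = p (- h) * p (- 1)"
  by (simp_all flip: p_add) (rule arg_cong[of _ _ p], simp)+

lemma p_inverse: "p h * p (- h) = 1"
  using p_add[of h "- h"] by simp

text \<open>Deleting \<open>X\<close> turns the relation at \<open>h\<close> into
  \<open>br (h + 1)\<close> times that at \<open>h + 1\<close>. Deleting \<open>Y\<close> turns it
  into a multiple of \<open>br h\<close> times that at \<open>h - 1\<close>; as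
  \<open>br 0 = 0\<close>, the induction never leaves the heights \<open>h \<ge> 0\<close>.\<close>

lemma paths_lower:
  assumes "h \<ge> 0"
  shows "paths_X t (p (- 1)) (h + 1) w + p (- h - 1) * paths_Y t (p (- 1)) h w = 0"
  using assms
proof (induction w arbitrary: h)
  case Nil
  then show ?case by (simp add: paths_X_Nil paths_Y_Nil)
next
  case (Cons a w)
  define b where "b = br h"
  define P where "P = p h"
  define P' where "P' = p (- h)"
  define Q where "Q = p 1"
  define Q' where "Q' = p (- 1)"
  note defs = b_def[symmetric] P_def[symmetric] P'_def[symmetric] Q_def[symmetric] Q'_def[symmetric]
  have inv: "P * P' = 1" "Q * Q' = 1" using p_inverse[of h] p_inverse[of 1] by (simp_all add: defs)
  show ?case
  proof (cases a)
    case X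
    have "paths_X t Q' (h + 2) w + P' * Q' * Q' * paths_Y t Q' (h + 1) w = 0"
      using Cons.IH[of "h + 1"] Cons.prems p_simps(2)[of h] by (simp add: defs add.commute)
    then have "br (h + 1) * paths_X t Q' (h + 2) w + br (h + 1) * (P' * Q' * Q') * paths_Y t Q' (h + 1) w = 0"
      by (metis distrib_left mult.assoc mult_zero_right)
    \<comment> \<open>The recurrence splits the coefficient into the two contributions to
      \<open>paths_Y\<close> at \<open>h + 1\<close> that the deletion of \<open>X\<close>
      produces.\<close>
    moreover have "br (h + 1) = Q * b + P'" using br_Suc by (simp add: defs)
    then have "br (h + 1) * (P' * Q' * Q') = P' * Q' * b + P' * Q' * (P' * Q')"
      using inv(2) by algebra
    ultimately have "br (h + 1) * paths_X t Q' (h + 2) w +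
        (P' * Q' * b + P' * Q' * (P' * Q')) * paths_Y t Q' (h + 1) w = 0" by simp
    then show ?thesis
      unfolding X paths_X_Cons paths_Y_Cons p_simps defs by (simp add: algebra_simps)
  next
    case Y
    have "b * (paths_X t Q' h w + P' * paths_Y t Q' (h - 1) w) = 0"
    proof (cases "h = 0")
      case True
      then show ?thesis by (simp add: b_def)
    next
      case False
      then show ?thesis using Cons.IH[of "h - 1"] Cons.prems by (simp add: defs)
    qed
    moreover have "br (h + 1) = Q' * b + P" using br_Suc' by (simp add: defs)
    ultimately show ?thesis
      using inv unfolding Y paths_X_Cons paths_Y_Cons p_simps defs
      apply simp
      by algebra
  qed
qed

text \<open>Deleting \<open>X\<close> gives \<open>br h\<close> times the relation at
  \<open>h + 1\<close>. Deleting \<open>Y\<close> leaves a term in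
  \<open>paths_X t (p (- 1)) h\<close>, which \<open>paths_lower\<close> expresses by
  \<open>paths_Y\<close> at \<open>h - 1\<close>, to be combined with the relation at
  \<open>h - 1\<close>.\<close>

lemma paths_upper:
  assumes "h \<ge> 0"
  shows "br h * paths_X t (p 1) (h + 1) w + p (- h) * br (h + 1) * paths_Y t (p 1) h w = paths_Y t (p (- 1)) h w"
  using assms
proof (induction w arbitrary: h)
  case Nil
  then show ?case by (simp add: paths_X_Nil paths_Y_Nil)
next
  case (Cons a w)
  define b where "b = br h"
  define P where "P = p h"
  define P' where "P' = p (- h)"
  define Q where "Q = p 1"
  define Q' where "Q' = p (- 1)"
  note defs = b_def[symmetric] P_def[symmetric] P'_def[symmetric] Q_def[symmetric] Q'_def[symmetric]
  have inv: "P * P' = 1" "Q * Q' = 1" using p_inverse[of h] p_inverse[of 1] by (simp_all add: defs)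
  show ?case
  proof (cases a)
    case X
    have P'': "p (- (h + 1)) = P' * Q'"
      unfolding P'_def Q'_def by (simp flip: p_add)
    have "br (h + 1) * paths_X t Q (h + 2) w + P' * Q' * br (h + 2) * paths_Y t Q (h + 1) w = paths_Y t Q' (h + 1) w"
      using Cons.IH[of "h + 1"] Cons.prems unfolding P'' by (simp add: defs add.assoc)
    moreover have "br (h + 2) = Q * br (h + 1) + P' * Q'"
      using br_Suc[of "h + 1"] unfolding P'' by (simp add: defs add.assoc)
    then have "P' * Q' * br (h + 2) = P' * Q' * (P' * Q') + P' * br (h + 1)"
      using inv(2) by algebra
    ultimately have "b * (br (h + 1) * paths_X t Q (h + 2) w +
        (P' * Q' * (P' * Q') + P' * br (h + 1)) * paths_Y t Q (h + 1) w) = b * paths_Y t Q' (h + 1) w" by simp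
    then show ?thesis
      unfolding X paths_X_Cons paths_Y_Cons p_simps defs by (simp add: algebra_simps)
  next
    case Y
    have *: "br (h + 1) = Q' * b + P" using br_Suc' by (simp add: defs)
    show ?thesis
    proof (cases "h = 0")
      case True
      \<comment> \<open>From height 0 only the empty path counts, so both sides reduce to
        \<open>- t\<close> times the same \<open>alternating t X\<close>.\<close>
      then show ?thesis unfolding Y paths_X_Cons paths_Y_Cons by (simp add: paths_X_0)
    next
      case False
      then have 1: "paths_X t Q' h w + P' * paths_Y t Q' (h - 1) w = 0"
        using paths_lower[of "h - 1" t w] Cons.prems by (simp add: defs)
      have 2: "br (h - 1) * paths_X t Q h w + P' * Q * b * paths_Y t Q (h - 1) w = paths_Y t Q' (h - 1) w"
        using Cons.IH[of "h - 1"] False Cons.prems p_add[of "- h" 1] by (simp add: defs)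
      have 3: "b = Q' * br (h - 1) + P * Q'"
        using br_Suc'[of "h - 1"] p_add[of h "- 1"] by (simp add: defs)
      show ?thesis
        using inv * 1 2 3 unfolding Y paths_X_Cons paths_Y_Cons p_simps defs
        apply simp
        by algebra
    qed
  qed
qed

text \<open>\<open>\<theta>\<close> stands for t d/dt. The first relation is the differential
  equation multiplied by q - 1/q, since [n] (q - 1/q) = q^n - q^(-n) is a difference of two
  dilations. The second is the first after deletion of \<open>X\<close>, and deleting
  \<open>Y\<close> from it leads back to the first.\<close>

lemma alternating_derivation:
  assumes "\<theta> 0 = 0" "\<theta> 1 = 0" "\<And>x. \<theta> (- (t * x)) = - (t * x) - t * \<theta> x"
  shows "(p 1 - p (- 1)) * \<theta> (alternating t X w)
    + (catalan_path br (p 1 * t) \<star> alternating t X) w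
    - (catalan_path br (p (- 1) * t) \<star> alternating t X) w = 0 \<and>
    (p 1 - p (- 1)) * \<theta> (alternating t Y w)
    + (catalan_path br (p 1 * t) \<star> alternating t Y) w
    - (catalan_path br (p (- 1) * t) \<star> alternating t Y) w + paths_X t (p 1) 1 w - paths_X t (p (- 1)) 1 w = 0"
proof (induction w)
  case Nil
  then show ?case by (simp add: assms paths_X_Nil)
next
  case (Cons a w)
  have deriv: "(catalan_path br (c * t) \<star> alternating t X) (X # w)
      = paths_X t c 1 w + (catalan_path br (c * t) \<star> alternating t Y) w"
    "(catalan_path br (c * t) \<star> alternating t X) (Y # w) = 0"
    "(catalan_path br (c * t) \<star> alternating t Y) (X # w) = paths_Y t c 1 w"
    "(catalan_path br (c * t) \<star> alternating t Y) (Y # w)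
      = - t * (catalan_path br (c * t) \<star> alternating t X) w" for c
    by (simp_all add: sh_X[OF homogeneous_catalan_path] sh_Y[OF homogeneous_catalan_path]
      sh_scale_left sh_scale_right sh_minus_right paths_X_def paths_Y_def del: word_fun_shuffle.simps)
  show ?case
  proof (cases a)
    case X
    \<comment> \<open>Deleting \<open>X\<close> from the second relation leaves paths from heights 1
      and 2; the two path relations at height 1 cancel them.\<close>
    have "paths_X t (p (- 1)) 2 w + p (- 2) * paths_Y t (p (- 1)) 1 w = 0"
      using paths_lower[of 1 t w] by simp
    moreover have "paths_X t (p 1) 2 w + p (- 1) * br 2 * paths_Y t (p 1) 1 w = paths_Y t (p (- 1)) 1 w"
      using paths_upper[of 1 t w] by simp
    moreover have "p (- 1) * br 2 = 1 + p (- 2)"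
      using br_Suc[of 1] p_inverse[of 1] p_add[of "-1" "-1"]
      by (simp add: distrib_left mult.commute)
    ultimately show ?thesis
      using Cons.IH unfolding X deriv paths_X_Cons
      apply (simp add: assms)
      by algebra
  next
    case Y
    \<comment> \<open>Here \<open>paths_X\<close> reaches height 0, and the resulting (q - 1/q) t
      Gt(-t) cancels against the term \<open>- (t * x)\<close> in the rule for
      \<open>\<theta>\<close>.\<close>
    have "t * ((p 1 - p (- 1)) * \<theta> (alternating t X w)
        + (catalan_path br (p 1 * t) \<star> alternating t X) w
        - (catalan_path br (p (- 1) * t) \<star> alternating t X) w) = 0"
      using Cons.IH by simp
    then show ?thesis
      unfolding Y deriv paths_X_Cons
      by (simp add: assms paths_X_0 algebra_simps del: word_fun_shuffle.simps)
  qed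
qed

end

section \<open>Commutation of the powers of xy\<close>

definition word_ind :: "letter list \<Rightarrow> letter list \<Rightarrow> 'b::comm_ring_1" where
  "word_ind u w = (if w = u then 1 else 0)"

definition xy_word :: "nat \<Rightarrow> letter list" where
  "xy_word n = concat (replicate n [X, Y])"

lemma xy_word_simps: "xy_word 0 = []" "xy_word (Suc n) = X # Y # xy_word n"
  by (simp_all add: xy_word_def)

lemma word_weight_xy_word [simp]: "word_weight (xy_word n) = 0"
  by (induction n) (simp_all add: xy_word_simps)

context quantum_powers
begin

text \<open>\<open>W i\<close> is \<open>G (Suc i)\<close> with its initial \<open>X\<close>
  deleted, and deleting \<open>Y\<close> from \<open>W i\<close> gives \<open>G i\<close>. All other
  deletions give 0, so the two families are closed under deletion.\<close>

abbreviation G :: "nat \<Rightarrow> letter list \<Rightarrow> 'b" where "G i \<equiv> word_ind (xy_word i)"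
abbreviation W :: "nat \<Rightarrow> letter list \<Rightarrow> 'b" where "W i \<equiv> word_ind (Y # xy_word i)"

lemma homogeneous_G: "homogeneous 0 (G i)" and homogeneous_W: "homogeneous (- 1) (W i)"
  by (simp_all add: homogeneous_def word_ind_def)

lemma G_W_deletion:
  "(\<lambda>u. G 0 (a # u)) = (\<lambda>u. 0)"
  "(\<lambda>u. G (Suc i) (X # u)) = W i" "(\<lambda>u. G i (Y # u)) = (\<lambda>u. 0)"
  "(\<lambda>u. W i (X # u)) = (\<lambda>u. 0)" "(\<lambda>u. W i (Y # u)) = G i"
  by (cases i; auto simp: word_ind_def xy_word_simps)+

lemma G_0: "G 0 = (\<lambda>u. if u = [] then 1 else 0)"
  by (auto simp: word_ind_def xy_word_simps)

lemma G_W_Cons: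
  "(G (Suc i) \<star> f) (X # w) = (W i \<star> f) w + (G (Suc i) \<star> (\<lambda>u. f (X # u))) w"
  "(G 0 \<star> f) (X # w) = (G 0 \<star> (\<lambda>u. f (X # u))) w"
  "(G i \<star> f) (Y # w) = (G i \<star> (\<lambda>u. f (Y # u))) w"
  "(W i \<star> f) (X # w) = p (- 2) * (W i \<star> (\<lambda>u. f (X # u))) w"
  "(W i \<star> f) (Y # w) = (G i \<star> f) w + p 2 * (W i \<star> (\<lambda>u. f (Y # u))) w"
  by (simp_all add: sh_X[OF homogeneous_G] sh_X[OF homogeneous_W] sh_Y[OF homogeneous_G]
      sh_Y[OF homogeneous_W] G_W_deletion del: word_fun_shuffle.simps)

text \<open>
  All four relations are needed for the induction: deleting an initial letter turns each of them
  into instances of the others.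
\<close>

lemma G_W_relations:
  "(G i \<star> G j) w = (G j \<star> G i) w \<and> (W i \<star> W j) w = (W j \<star> W i) w \<and>
    (W i \<star> G (Suc j)) w - (G (Suc j) \<star> W i) w = (W j \<star> G (Suc i)) w - (G (Suc i) \<star> W j) w \<and>
    (G i \<star> W j) w - p 2 * (W j \<star> G i) w = (G j \<star> W i) w - p 2 * (W i \<star> G j) w"
proof (induction w arbitrary: i j)
  case Nil
  show ?case by (simp add: word_ind_def)
next
  case (Cons a w)
  have GG: "(G i \<star> G j) w = (G j \<star> G i) w" and WW: "(W i \<star> W j) w = (W j \<star> W i) w"
    and WG: "(W i \<star> G (Suc j)) w - (G (Suc j) \<star> W i) w =
      (W j \<star> G (Suc i)) w - (G (Suc i) \<star> W j) w"
    and GW: "(G i \<star> W j) w - p 2 * (W j \<star> G i) w = (G j \<star> W i) w - p 2 * (W i \<star> G j) w" for i j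
    using Cons.IH by blast+
  have p2: "p 2 * (p (- 2) * x) = x" for x
    by (simp flip: p_add mult.assoc)
  show ?case
  proof (cases a)
    case X
    have "(G i \<star> G j) (X # w) = (G j \<star> G i) (X # w)"
    proof (cases "i = 0 \<or> j = 0")
      case True
      then show ?thesis
        by (auto simp: G_0 simp del: word_fun_shuffle.simps)
    next
      case False
      then obtain i' j' where "i = Suc i'" "j = Suc j'" by (metis not0_implies_Suc)
      then show ?thesis
        using WG[of i' j'] by (simp add: G_W_Cons G_W_deletion algebra_simps del: word_fun_shuffle.simps)
    qed
    \<comment> \<open>Each side of the fourth relation vanishes: the twist \<open>p (- 2)\<close>
      cancels the factor \<open>p 2\<close>, and what remains commutes by the second
      relation.\<close>
    moreover have "(G i \<star> W j) (X # w) - p 2 * (W j \<star> G i) (X # w) = 0" for i j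
      using WW by (cases i) (simp_all add: G_W_Cons p2 G_W_deletion del: word_fun_shuffle.simps)
    ultimately show ?thesis
      using WW[of i j] unfolding X
      by (simp add: G_W_Cons G_W_deletion algebra_simps del: word_fun_shuffle.simps)
  next
    case Y
    \<comment> \<open>Both sides of the third relation become commutators of powers of xy, hence the
      instances with \<open>Suc\<close>.\<close>
    show ?thesis
      using GG[of i j] GG[of i "Suc j"] GG[of j "Suc i"] GW[of i j] unfolding Y
      by (simp add: G_W_Cons G_W_deletion algebra_simps del: word_fun_shuffle.simps)
  qed
qed

end

lemma coef_one [simp]: "coef 1 w = word_ind [] w"
  by (simp add: lookup_one word_ind_def zero_list_def when_def)

lemma coef_xy_power: "coef (word [X, Y] ^ n :: 'a::field free_alg) = word_ind (xy_word n)"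
proof -
  have "word [X, Y] ^ n = (word (xy_word n) :: 'a free_alg)"
  proof (induction n)
    case 0
    show ?case by (simp add: xy_word_simps flip: zero_list_def)
  next
    case (Suc n)
    then show ?case by (simp add: mult_single plus_list_def xy_word_simps)
  qed
  then show ?thesis by (auto simp: fun_eq_iff word_ind_def lookup_single when_def)
qed

lemma shuffle_xy_power_commute:
  fixes q :: "'a::field"
  assumes "q \<noteq> 0"
  shows "shuffle q (word [X, Y] ^ i) (word [X, Y] ^ j) = shuffle q (word [X, Y] ^ j) (word [X, Y] ^ i)"
proof (rule poly_mapping_eqI)
  interpret quantum_powers "\<lambda>n. q powi n" by (rule quantum_powers_powi) fact
  show "coef (shuffle q (word [X, Y] ^ i) (word [X, Y] ^ j)) w =
    coef (shuffle q (word [X, Y] ^ j) (word [X, Y] ^ i)) w" for w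
    using G_W_relations by (simp add: lookup_shuffle assms coef_xy_power)
qed

section \<open>From generating functions to a recursion for the powers of xy\<close>

lemma word_fun_shuffle_fps_nth:
  "fps_nth (word_fun_shuffle (\<lambda>n. fps_const (p n)) f g w) n =
    (\<Sum>i\<le>n. word_fun_shuffle p (\<lambda>u. fps_nth (f u) i) (\<lambda>u. fps_nth (g u) (n - i)) w)"
proof (induction w arbitrary: f g)
  case Nil
  show ?case by (simp add: fps_mult_nth atMost_atLeast0)
qed (simp add: sum.distrib)

text \<open>Each \<open>Y\<close> carries a factor \<open>- t\<close>. In the second formula the
  word begins with a further \<open>Y\<close>, so the exponent exceeds the number of pairs xy by one
  and there is no constant term.\<close>

lemma alternating_nth:
  "fps_nth (alternating fps_X X w :: 'a::comm_ring_1 fps) n = (- 1) ^ n * word_ind (xy_word n) w" (is "?X w n")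
  "fps_nth (alternating fps_X Y w :: 'a fps) n =
    (case n of 0 \<Rightarrow> 0 | Suc k \<Rightarrow> (- 1) ^ n * word_ind (Y # xy_word k) w)" (is "?Y w n")
proof -
  have "?X w n \<and> ?Y w n"
  proof (induction w arbitrary: n)
    case Nil
    show ?case by (cases n) (simp_all add: word_ind_def xy_word_simps)
  next
    case (Cons a w)
    then show ?case
      by (cases a; cases n) (simp_all add: word_ind_def xy_word_simps)
  qed
  then show "?X w n" "?Y w n" by blast+
qed

lemma qint_Suc:
  fixes q :: "'a::field"
  assumes "q \<noteq> 0" "q - inverse q \<noteq> 0"
  shows "qint q (h + 1) = q * qint q h + q powi (- h)"
    and "qint q (h + 1) = inverse q * qint q h + q powi h"
proof -
  have *: "q powi (h + 1) = q powi h * q" "q powi (- (h + 1)) = q powi (- h) * inverse q"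
    using assms power_int_add[of q "- h" "- 1"] by (simp_all add: power_int_add power_int_minus)
  have qint: "qint q k * (q - inverse q) = q powi k - q powi (- k)" for k
    using assms by (simp add: qint_def)
  have "qint q (h + 1) * (q - inverse q) =
      q * (qint q h * (q - inverse q)) + q powi (- h) * (q - inverse q)"
    "qint q (h + 1) * (q - inverse q) =
      inverse q * (qint q h * (q - inverse q)) + q powi h * (q - inverse q)"
    unfolding qint * using assms(1) by (simp_all add: algebra_simps)
  then have "qint q (h + 1) * (q - inverse q) = (q * qint q h + q powi (- h)) * (q - inverse q)"
    "qint q (h + 1) * (q - inverse q) = (inverse q * qint q h + q powi h) * (q - inverse q)"
    by (simp_all add: distrib_right mult.assoc)
  then show "qint q (h + 1) = q * qint q h + q powi (- h)"
    "qint q (h + 1) = inverse q * qint q h + q powi h" using assms by simp_all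
qed

lemma path_sum_nth:
  "fps_nth (path_sum (\<lambda>h. fps_const (b h)) (fps_const a * fps_X) h w) n =
    (if h + word_weight w = 0 \<and> n = count_list w Y
     then a ^ n * (\<Prod>i<length w. b (h + word_weight (take i w))) else 0)"
proof (induction w arbitrary: h n)
  case Nil
  show ?case by (cases n) simp_all
next
  case (Cons c w)
  show ?case
  proof (cases c)
    case X
    then show ?thesis
      by (simp add: Cons.IH prod.lessThan_Suc_shift add.assoc del: prod.lessThan_Suc)
  next
    case Y
    then show ?thesis
      by (cases n)
        (auto simp: Cons.IH prod.lessThan_Suc_shift mult.assoc mult.left_commute diff_add_eq add_diff_eq
          simp del: prod.lessThan_Suc)
  qed
qed

lemma length_eq_weight: "int (length w) = 2 * int (count_list w Y) + word_weight w"
proof (induction w)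
  case (Cons a w)
  then show ?case by (cases a) simp_all
qed simp

text \<open>The weight changes by one at each letter, so it passes -1 before it can be smaller. For
  a path that starts at height 1 this is a visit to height 0, where the q-integer vanishes.\<close>

lemma word_weight_crosses:
  assumes "word_weight (take i w) < 0" "i \<le> length w"
  obtains j where "j \<le> i" "word_weight (take j w) = - 1"
proof -
  \<comment> \<open>The intermediate value lemma climbs from a smaller to a larger value, hence the
    negated weights.\<close>
  have step: "\<bar>- word_weight (take (Suc j) w) - - word_weight (take j w)\<bar> \<le> 1" if "j < i" for j
  proof -
    have "\<bar>letter_weight (w ! j)\<bar> \<le> 1" by (cases "w ! j") simp_all
    then show ?thesis using that assms(2) by (simp add: take_Suc_conv_app_nth)
  qed
  have "\<exists>j\<le>i. - word_weight (take j w) = 1"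
    by (rule nat_ivt_aux) (use step assms in auto)
  then show thesis using that by force
qed

text \<open>Below, \<open>catalan_xy q 0 = 0\<close> is a convention that allows sums to start at \<open>0\<close>.\<close>

definition catalan_xy :: "'a::field \<Rightarrow> nat \<Rightarrow> 'a free_alg" where
  "catalan_xy q n = (if n = 0 then 0 else word [X] * catalan_elt q (n - 1) * word [Y])"

lemma catalan_xy_0 [simp]: "catalan_xy q 0 = 0"
  by (simp add: catalan_xy_def)

lemma smul_word: "smul c (word w) = Poly_Mapping.single w c"
  by (simp add: smul_def)

lemma catalan_xy_Suc:
  "catalan_xy q (Suc n) = (\<Sum>w | catalan w \<and> length w = 2 * n.
     Poly_Mapping.single (X # w @ [Y]) (\<Prod>i = 1..2 * n. qint q (1 + word_weight (take i w))))"
  by (simp add: catalan_xy_def catalan_elt_def smul_word sum_distrib_left sum_distrib_right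
      mult_single plus_list_def)

lemma coef_catalan_xy_Suc:
  "coef (catalan_xy q (Suc n)) (X # w @ [Y]) = (if catalan w \<and> length w = 2 * n
     then \<Prod>i = 1..2 * n. qint q (1 + word_weight (take i w)) else 0)"
  by (simp add: catalan_xy_Suc lookup_sum lookup_single when_def finite_words_of_length
      if_distrib[of "\<lambda>u. u = _"] sum.delta' cong: if_cong)

lemma coef_catalan_xy_eq_0:
  assumes "\<nexists>w. u = X # w @ [Y]"
  shows "coef (catalan_xy q n) u = 0"
proof (cases n)
  case (Suc m)
  show ?thesis unfolding Suc catalan_xy_Suc lookup_sum lookup_single when_def
    using assms by (intro sum.neutral) auto
qed simp

text \<open>A path from height 1 to 0 with nonzero weight stays positive until its last step. So it
  ends in \<open>Y\<close>, and removing the initial \<open>X\<close> of \<open>u\<close> and this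
  \<open>Y\<close> leaves a Catalan word.\<close>

lemma catalan_path_nth:
  fixes q :: "'a::field"
  assumes "q - inverse q \<noteq> 0"
  shows "fps_nth (catalan_path (\<lambda>h. fps_const (qint q h)) (fps_const a * fps_X) u) n =
    a ^ n * coef (catalan_xy q n) u"
proof (cases "\<exists>v. u = X # v")
  case False
  then show ?thesis
    using coef_catalan_xy_eq_0[of u q n]
    by (cases "(\<lambda>h. fps_const (qint q h), fps_const a * fps_X, u)" rule: catalan_path.cases) auto
next
  case True
  then obtain v where u: "u = X # v" by blast
  \<comment> \<open>A path that comes down to height 0 before its end has a factor [0] = 0.\<close>
  have zero: "(\<Prod>i<length v. qint q (1 + word_weight (take i v))) = 0"
    if neg: "word_weight (take i v) < 0" and less: "i < length v" for i
  proof -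
    obtain j where "j \<le> i" "word_weight (take j v) = - 1"
      using word_weight_crosses[OF neg] less by (metis less_imp_le)
    then have "j \<in> {..<length v}" "qint q (1 + word_weight (take j v)) = 0"
      using less by (simp_all add: qint_def)
    then show ?thesis by (intro prod_zero) blast+
  qed
  show ?thesis
  proof (cases v rule: rev_cases)
    case Nil
    then show ?thesis using coef_catalan_xy_eq_0[of u q n] by (auto simp: u)
  next
    case (snoc w c)
    show ?thesis
    proof (cases c)
      case X
      \<comment> \<open>A path to 0 that ends with a step up was at height -1 before, so
        \<open>zero\<close> applies.\<close>
      have "1 + word_weight v = 0 \<Longrightarrow> (\<Prod>i<length v. qint q (1 + word_weight (take i v))) = 0"
        using zero[of "length w"] by (simp add: snoc X)
      moreover have "coef (catalan_xy q n) u = 0"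
        by (rule coef_catalan_xy_eq_0) (simp add: u snoc X)
      ultimately show ?thesis by (auto simp: u path_sum_nth)
    next
      case Y
      \<comment> \<open>The factor \<open>i = 0\<close> on the left is [1] = 1; dropping it shifts
        the range to \<open>1..length w\<close>, as \<open>v\<close> is longer than \<open>w\<close>
        by one.\<close>
      have prod: "(\<Prod>i<length v. qint q (1 + word_weight (take i v))) =
          (\<Prod>i = 1..length w. qint q (1 + word_weight (take i w)))"
      proof -
        have "(\<Prod>i<length v. qint q (1 + word_weight (take i v))) =
            qint q 1 * (\<Prod>i<length w. qint q (1 + word_weight (take (Suc i) v)))"
          by (simp add: snoc prod.lessThan_Suc_shift del: prod.lessThan_Suc take_append)
        also have "qint q 1 = 1"
          using assms by (simp add: qint_def)
        also have "(\<Prod>i<length w. qint q (1 + word_weight (take (Suc i) v))) =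
            (\<Prod>i = 1..length w. qint q (1 + word_weight (take i w)))"
          by (rule prod.reindex_bij_witness[of _ "\<lambda>i. i - 1" Suc]) (auto simp: snoc)
        finally show ?thesis by simp
      qed
      have len: "length w = 2 * m" if "word_weight w = 0" "count_list w Y = m" for m
        using length_eq_weight[of w] that by simp
      show ?thesis
      proof (cases "word_weight w = 0 \<and> n = Suc (count_list w Y)")
        case False
        then have "\<not> (catalan w \<and> length w = 2 * m)" if "n = Suc m" for m
          using length_eq_weight[of w] that by (auto simp: catalan_def)
        then have "coef (catalan_xy q n) u = 0"
          by (cases n) (auto simp: u snoc Y coef_catalan_xy_Suc)
        then show ?thesis using False by (auto simp: u snoc Y path_sum_nth)
      next
        case True
        have "(\<Prod>i<length v. qint q (1 + word_weight (take i v))) = 0" if not_catalan: "\<not> catalan w"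
        proof -
          obtain i where "i < length w" "word_weight (take i w) < 0"
            using not_catalan True by (auto simp: catalan_def not_le)
          then show ?thesis using zero[of i] by (simp add: snoc)
        qed
        then have "coef (catalan_xy q n) u = (\<Prod>i<length v. qint q (1 + word_weight (take i v)))"
          using True len[of "n - 1"] unfolding prod
          by (simp add: u snoc Y coef_catalan_xy_Suc)
        then show ?thesis using True by (simp add: u snoc Y path_sum_nth)
      qed
    qed
  qed
qed

text \<open>This is the coefficient of t^n in the differential equation, divided by q - 1/q: the
  difference of the path series at qt and t/q contributes q^i - q^(-i), which becomes [i].\<close>

lemma xy_power_recursion:
  fixes q :: "'a::field"
  assumes "q \<noteq> 0" "q - inverse q \<noteq> 0"
  shows "smul (of_nat n * (- 1) ^ n) (word [X, Y] ^ n) =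
    - (\<Sum>i\<le>n. smul (qint q (int i)) (shuffle q (catalan_xy q i) (smul ((- 1) ^ (n - i)) (word [X, Y] ^ (n - i)))))"
proof (rule poly_mapping_eqI)
  fix w
  let ?br = "\<lambda>h. fps_const (qint q h)"
  interpret fps: quantum_integers "\<lambda>n. fps_const (q powi n)" ?br
    using qint_Suc[OF assms] assms
    by unfold_locales (simp_all add: power_int_add qint_def)
  interpret q: quantum_powers "\<lambda>n. q powi n" by (rule quantum_powers_powi) fact
  have "(fps_const q - fps_const (inverse q)) * (fps_X * fps_deriv (alternating fps_X X w))
    + fps.sh (catalan_path ?br (fps_const q * fps_X)) (alternating fps_X X) w
    - fps.sh (catalan_path ?br (fps_const (inverse q) * fps_X)) (alternating fps_X X) w = 0"
    using fps.alternating_derivation[of "\<lambda>f. fps_X * fps_deriv f" fps_X w]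
    by (simp add: algebra_simps)
  then have "fps_nth ((fps_const q - fps_const (inverse q)) * (fps_X * fps_deriv (alternating fps_X X w))
    + fps.sh (catalan_path ?br (fps_const q * fps_X)) (alternating fps_X X) w
    - fps.sh (catalan_path ?br (fps_const (inverse q) * fps_X)) (alternating fps_X X) w) n = 0"
    by simp
  moreover have euler_nth: "fps_nth (fps_X * fps_deriv f) n = of_nat n * fps_nth f n" for f :: "'a fps"
    by (cases n) simp_all
  ultimately have *: "(q - inverse q) * (of_nat n * ((- 1) ^ n * word_ind (xy_word n) w)) +
     (\<Sum>i\<le>n. (q ^ i - inverse q ^ i) *
       q.sh (coef (catalan_xy q i)) (\<lambda>u. (- 1) ^ (n - i) * word_ind (xy_word (n - i)) u) w) = 0"
    by (simp add: word_fun_shuffle_fps_nth catalan_path_nth[OF assms(2)] alternating_nth euler_nth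
        q.sh_scale_left left_diff_distrib sum_subtractf add_diff_eq flip: fps_const_sub)
  have qint: "(q - inverse q) * (qint q (int i) * x) = (q ^ i - inverse q ^ i) * x" for i x
    using assms by (simp add: qint_def power_int_minus power_inverse)
  have coef_smul: "coef (smul c f) = (\<lambda>u. c * coef f u)" for c :: 'a and f
    by (rule ext) simp
  have "(q - inverse q) * coef (smul (of_nat n * (- 1) ^ n) (word [X, Y] ^ n)) w =
    (q - inverse q) * coef (- (\<Sum>i\<le>n. smul (qint q (int i)) (shuffle q (catalan_xy q i)
      (smul ((- 1) ^ (n - i)) (word [X, Y] ^ (n - i)))))) w"
    using * by (simp add: lookup_sum sum_distrib_left qint lookup_shuffle assms(1) coef_smul
        coef_xy_power mult.assoc eq_neg_iff_add_eq_0 del: lookup_smul)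
  then show "coef (smul (of_nat n * (- 1) ^ n) (word [X, Y] ^ n)) w =
    coef (- (\<Sum>i\<le>n. smul (qint q (int i)) (shuffle q (catalan_xy q i)
      (smul ((- 1) ^ (n - i)) (word [X, Y] ^ (n - i)))))) w"
    using assms(2) by (simp only: mult_cancel_left simp_thms)
qed

section \<open>Differential equations for power series over the q-shuffle algebra\<close>

lemma smul_sum: "smul c (\<Sum>i\<in>A. h i) = (\<Sum>i\<in>A. smul c (h i))"
  and smul_smul: "smul c (smul d f) = smul (c * d) f"
  and smul_add_scalar: "smul (c + d) f = smul c f + smul d f"
  and smul_minus_scalar: "smul (- c) f = - smul c f"
  by (rule poly_mapping_eqI; simp add: lookup_add lookup_sum sum_distrib_left algebra_simps)+

lemma smul_1 [simp]: "smul 1 f = f" and smul_0 [simp]: "smul 0 f = 0"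
  by (rule poly_mapping_eqI; simp)+

lemma smul_cancel:
  assumes "smul c f = smul c g" "c \<noteq> 0"
  shows "f = g"
proof (rule poly_mapping_eqI)
  show "coef f w = coef g w" for w
    using arg_cong[OF assms(1), of "\<lambda>h. coef h w"] assms(2) by simp
qed

locale shuffle_algebra =
  fixes q :: "'a::field_char_0"
  assumes q_nonzero [simp]: "q \<noteq> 0"
begin

sublocale powers: quantum_powers "\<lambda>n. q powi n"
  by (rule quantum_powers_powi) simp

sublocale fps_powers: quantum_powers "\<lambda>n. fps_const (q powi n)"
  by standard (simp_all add: power_int_add)

abbreviation sh (infixl "\<odot>" 70) where "f \<odot> g \<equiv> shuffle q f g"
abbreviation fsh (infixl "\<circledast>" 70) where "f \<circledast> g \<equiv> fps_shuffle q f g"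

lemma coef_sh: "coef (f \<odot> g) = word_fun_shuffle (\<lambda>n. q powi n) (coef f) (coef g)"
  by (rule ext) (simp add: lookup_shuffle)

lemma coef_fun:
  "coef (f + g) = (\<lambda>w. coef f w + coef g w)" "coef (smul c f) = (\<lambda>w. c * coef f w)"
  "coef (\<Sum>i\<in>A. h i) = (\<lambda>w. \<Sum>i\<in>A. coef (h i) w)"
  "coef 1 = (\<lambda>w. if w = [] then 1 else 0)"
  by (auto simp: fun_eq_iff lookup_add lookup_sum lookup_one when_def word_ind_def zero_list_def)

lemma sh_assoc: "(f \<odot> g) \<odot> h = f \<odot> (g \<odot> h)"
  and sh_add_left: "(f + g) \<odot> h = f \<odot> h + g \<odot> h"
  and sh_add_right: "f \<odot> (g + h) = f \<odot> g + f \<odot> h"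
  and sh_smul_left: "smul c f \<odot> g = smul c (f \<odot> g)"
  and sh_smul_right: "f \<odot> smul c g = smul c (f \<odot> g)"
  and sh_sum_left: "(\<Sum>i\<in>A. k i) \<odot> g = (\<Sum>i\<in>A. k i \<odot> g)"
  and sh_sum_right: "g \<odot> (\<Sum>i\<in>A. k i) = (\<Sum>i\<in>A. g \<odot> k i)"
  and sh_one_left [simp]: "1 \<odot> f = f"
  and sh_one_right [simp]: "f \<odot> 1 = f"
  by (rule poly_mapping_eqI; simp add: coef_sh coef_fun powers.sh_assoc powers.sh_add_left
      powers.sh_add_right powers.sh_scale_left powers.sh_scale_right powers.sh_sum_left
      powers.sh_sum_right del: coef_one lookup_smul)+

lemma fsh_nth: "fps_nth (f \<circledast> g) n = (\<Sum>i\<le>n. fps_nth f i \<odot> fps_nth g (n - i))"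
  by (simp add: fps_shuffle_def)

text \<open>Exchanging the roles of t and the words turns a series over the shuffle algebra into a
  function from words to scalar power series. There \<open>fsh\<close> becomes the product of the
  model over power series, whose associativity is known.\<close>

definition coef_fps :: "'a free_alg fps \<Rightarrow> letter list \<Rightarrow> 'a fps" where
  "coef_fps f w = Abs_fps (\<lambda>n. coef (fps_nth f n) w)"

lemma coef_fps_fsh: "coef_fps (f \<circledast> g) = fps_powers.sh (coef_fps f) (coef_fps g)"
proof (intro ext fps_ext)
  show "fps_nth (coef_fps (f \<circledast> g) w) n = fps_nth (fps_powers.sh (coef_fps f) (coef_fps g) w) n" for w n
    by (simp add: word_fun_shuffle_fps_nth coef_fps_def fsh_nth lookup_sum lookup_shuffle)
qed

lemma coef_fps_inject: "coef_fps f = coef_fps g \<Longrightarrow> f = g"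
proof (intro fps_ext poly_mapping_eqI)
  show "coef (fps_nth f n) w = coef (fps_nth g n) w" if "coef_fps f = coef_fps g" for n w
    using arg_cong[OF that, of "\<lambda>h. fps_nth (h w) n"] by (simp add: coef_fps_def)
qed

lemma fsh_assoc: "(f \<circledast> g) \<circledast> h = f \<circledast> (g \<circledast> h)"
  by (rule coef_fps_inject) (simp add: fun_eq_iff coef_fps_fsh fps_powers.sh_assoc)

lemma fsh_add_left: "(f + g) \<circledast> h = f \<circledast> h + g \<circledast> h"
  by (rule fps_ext) (simp add: fsh_nth sh_add_left sum.distrib)

lemma fsh_one_left [simp]: "1 \<circledast> f = f"
proof (rule fps_ext)
  fix n
  have "fps_nth (1 \<circledast> f) n = (\<Sum>i\<le>n. if i = 0 then fps_nth f n else 0)"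
    unfolding fsh_nth by (rule sum.cong) simp_all
  then show "fps_nth (1 \<circledast> f) n = fps_nth f n" by simp
qed

lemma fsh_one_right [simp]: "f \<circledast> 1 = f"
proof (rule fps_ext)
  fix n
  have "fps_nth (f \<circledast> 1) n = (\<Sum>i\<le>n. if i = n then fps_nth f n else 0)"
    unfolding fsh_nth by (rule sum.cong) auto
  then show "fps_nth (f \<circledast> 1) n = fps_nth f n" by simp
qed

lemma fsh_commute:
  assumes "\<And>i j. fps_nth f i \<odot> fps_nth g j = fps_nth g j \<odot> fps_nth f i"
  shows "f \<circledast> g = g \<circledast> f"
proof (rule fps_ext)
  show "fps_nth (f \<circledast> g) n = fps_nth (g \<circledast> f) n" for n
    unfolding fsh_nth
    by (rule sum.reindex_bij_witness[of _ "\<lambda>i. n - i" "\<lambda>i. n - i"]) (auto simp: assms)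
qed

text \<open>This is the operator t d/dt.\<close>

definition euler :: "'a free_alg fps \<Rightarrow> 'a free_alg fps" where
  "euler f = Abs_fps (\<lambda>n. smul (of_nat n) (fps_nth f n))"

lemma euler_nth: "fps_nth (euler f) n = smul (of_nat n) (fps_nth f n)"
  by (simp add: euler_def)

lemma euler_fsh: "euler (f \<circledast> g) = euler f \<circledast> g + f \<circledast> euler g"
proof (rule fps_ext)
  fix n
  have "smul (of_nat n) (fps_nth f i \<odot> fps_nth g (n - i)) =
    smul (of_nat i) (fps_nth f i) \<odot> fps_nth g (n - i) +
    fps_nth f i \<odot> smul (of_nat (n - i)) (fps_nth g (n - i))" if "i \<le> n" for i
    using that by (simp add: sh_smul_left sh_smul_right of_nat_diff flip: smul_add_scalar)
  then show "fps_nth (euler (f \<circledast> g)) n = fps_nth (euler f \<circledast> g + f \<circledast> euler g) n"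
    by (simp add: euler_nth fsh_nth smul_sum flip: sum.distrib)
qed

lemma euler_one: "euler 1 = 0"
  by (rule fps_ext) (simp add: euler_nth)

text \<open>As \<open>A\<close> has no constant term, the n-th coefficient of
  \<open>A \<circledast> f\<close> involves only earlier coefficients of \<open>f\<close>; for n > 0
  the factor n on the left can be cancelled in characteristic 0.\<close>

lemma ode_unique:
  assumes "euler f = A \<circledast> f" "euler g = A \<circledast> g" "fps_nth A 0 = 0" "fps_nth f 0 = fps_nth g 0"
  shows "f = g"
proof (rule fps_ext)
  show "fps_nth f n = fps_nth g n" for n
  proof (induction n rule: less_induct)
    case (less n)
    show ?case
    proof (cases "n = 0")
      case False
      have "fps_nth A i \<odot> fps_nth f (n - i) = fps_nth A i \<odot> fps_nth g (n - i)" for i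
        using less.IH[of "n - i"] False assms(3) by (cases "i = 0") auto
      then have "smul (of_nat n) (fps_nth f n) = smul (of_nat n) (fps_nth g n)"
        by (simp add: fsh_nth assms(1,2) flip: euler_nth)
      then show ?thesis using False by (rule_tac smul_cancel) auto
    qed (simp add: assms(4))
  qed
qed

text \<open>The recursion behind \<open>ode_unique\<close> builds the coefficients of
  \<open>f\<close> from 1 and the coefficients of \<open>A\<close>, and \<open>z\<close> commutes
  with all of these.\<close>

lemma ode_commute:
  assumes "euler f = A \<circledast> f" "fps_nth A 0 = 0" "fps_nth f 0 = 1"
    and "\<And>i. z \<odot> fps_nth A i = fps_nth A i \<odot> z"
  shows "z \<odot> fps_nth f n = fps_nth f n \<odot> z"
proof (induction n rule: less_induct)
  case (less n)
  show ?case
  proof (cases "n = 0")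
    case False
    have "z \<odot> (fps_nth A i \<odot> fps_nth f (n - i)) = fps_nth A i \<odot> fps_nth f (n - i) \<odot> z" for i
    proof (cases "i = 0")
      case False
      then have "z \<odot> fps_nth f (n - i) = fps_nth f (n - i) \<odot> z"
        using less.IH[of "n - i"] \<open>n \<noteq> 0\<close> by simp
      then show ?thesis by (metis assms(4) sh_assoc)
    qed (simp add: assms(2))
    then have "z \<odot> fps_nth (euler f) n = fps_nth (euler f) n \<odot> z"
      by (simp add: assms(1) fsh_nth sh_sum_left sh_sum_right)
    then have "smul (of_nat n) (z \<odot> fps_nth f n) = smul (of_nat n) (fps_nth f n \<odot> z)"
      by (simp add: euler_nth sh_smul_left sh_smul_right)
    then show ?thesis using False by (rule_tac smul_cancel) auto
  qed (simp add: assms(3))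
qed

lemma fps_shuffle_prod_simps [simp]:
  "fps_shuffle_prod q [] = 1" "fps_shuffle_prod q (f # fs) = f \<circledast> fps_shuffle_prod q fs"
  by (simp_all add: fps_shuffle_prod_def)

lemma fps_shuffle_power_simps:
  "fps_shuffle_power q f 0 = 1" "fps_shuffle_power q f (Suc k) = f \<circledast> fps_shuffle_power q f k"
  by (simp_all add: fps_shuffle_power_def)

text \<open>The product rule gives one term for each factor; the hypothesis moves the derivative to
  the front in each of them and so makes them equal.\<close>

lemma euler_power:
  assumes "f \<circledast> euler f = euler f \<circledast> f"
  shows "euler (fps_shuffle_power q f (Suc k)) =
    fps_smul (of_nat (Suc k)) (euler f \<circledast> fps_shuffle_power q f k)"
proof (induction k)
  case 0
  show ?case
    by (rule fps_ext) (simp add: fps_shuffle_power_simps euler_fsh euler_one fps_smul_def fsh_nth)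
next
  case (Suc k)
  let ?p = "fps_shuffle_power q f"
  have smul: "f \<circledast> fps_smul c g = fps_smul c (f \<circledast> g)" for c g
    by (rule fps_ext) (simp add: fsh_nth fps_smul_def sh_smul_right smul_sum)
  have "euler (?p (Suc (Suc k))) = euler f \<circledast> ?p (Suc k) +
      fps_smul (of_nat (Suc k)) (f \<circledast> (euler f \<circledast> ?p k))"
    by (subst fps_shuffle_power_simps) (simp only: euler_fsh Suc smul)
  also have "f \<circledast> (euler f \<circledast> ?p k) = euler f \<circledast> ?p (Suc k)"
    by (simp add: fps_shuffle_power_simps assms flip: fsh_assoc)
  finally show ?case
    by (subst of_nat_Suc) (auto intro!: fps_ext simp: fps_smul_def smul_add_scalar simp del: of_nat_Suc)
qed

lemma exp_nth_0:
  assumes "fps_nth f 0 = 0"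
  shows "fps_nth (fps_shuffle_exp q f) 0 = 1"
  by (simp add: fps_shuffle_exp_nth assms fps_shuffle_power_simps)

lemma euler_exp:
  assumes "fps_nth f 0 = 0" "f \<circledast> euler f = euler f \<circledast> f"
  shows "euler (fps_shuffle_exp q f) = euler f \<circledast> fps_shuffle_exp q f"
proof (rule fps_ext)
  fix n
  let ?p = "fps_shuffle_power q f"
  \<comment> \<open>Powers beyond the j-th vanish in degree \<open>j\<close>, so the one bound
    \<open>n\<close> serves for all coefficients up to degree \<open>n\<close>.\<close>
  have exp: "fps_nth (fps_shuffle_exp q f) j = (\<Sum>k\<le>n. smul (1 / fact k) (fps_nth (?p k) j))"
    if "j \<le> n" for j
    unfolding fps_shuffle_exp_nth[OF assms(1)]
    using that assms(1) by (intro sum.mono_neutral_left) (auto simp: fps_shuffle_power_nth_eq_0)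
  have rhs: "fps_nth (euler f \<circledast> fps_shuffle_exp q f) n =
      (\<Sum>k\<le>n. smul (1 / fact k) (fps_nth (euler f \<circledast> ?p k) n))"
    unfolding fsh_nth by (simp add: exp sh_sum_right smul_sum sh_smul_right) (rule sum.swap)
  \<comment> \<open>Differentiation shifts the index of the exponential series by one, so the right
    side has one extra term \<open>k = n\<close>. It vanishes because \<open>euler f\<close> has no
    constant term.\<close>
  have top: "fps_nth (euler f \<circledast> ?p n) n = 0"
    unfolding fsh_nth
  proof (rule sum.neutral, rule ballI)
    show "fps_nth (euler f) i \<odot> fps_nth (?p n) (n - i) = 0" if "i \<in> {..n}" for i
      using that assms(1) by (cases "i = 0") (auto simp: euler_nth fps_shuffle_power_nth_eq_0)
  qed
  have step: "smul (1 / fact (Suc k)) (fps_nth (euler (?p (Suc k))) n) =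
      smul (1 / fact k) (fps_nth (euler f \<circledast> ?p k) n)" for k
    by (simp add: euler_power[OF assms(2)] fps_smul_def smul_smul del: of_nat_Suc)
  have "fps_nth (euler (fps_shuffle_exp q f)) n = (\<Sum>k\<le>n. smul (1 / fact k) (fps_nth (euler (?p k)) n))"
    by (simp add: euler_nth exp smul_sum smul_smul mult.commute)
  also have "\<dots> = (\<Sum>k<n. smul (1 / fact k) (fps_nth (euler f \<circledast> ?p k) n))"
    by (simp add: sum.atMost_shift step fps_shuffle_power_simps(1) euler_one del: fact_Suc)
  also have "\<dots> = fps_nth (euler f \<circledast> fps_shuffle_exp q f) n"
    by (simp add: rhs top flip: lessThan_Suc_atMost)
  finally show "fps_nth (euler (fps_shuffle_exp q f)) n = fps_nth (euler f \<circledast> fps_shuffle_exp q f) n" .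
qed

lemma dilate_nth: "fps_nth (fps_dilate c f) n = smul (c ^ n) (fps_nth f n)"
  by (simp add: fps_dilate_def)

lemma dilate_dilate: "fps_dilate c (fps_dilate d f) = fps_dilate (c * d) f"
  by (rule fps_ext) (simp add: dilate_nth smul_smul power_mult_distrib)

lemma dilate_euler: "euler (fps_dilate c f) = fps_dilate c (euler f)"
  by (rule fps_ext) (simp add: dilate_nth euler_nth smul_smul mult.commute)

lemma dilate_fsh: "fps_dilate c (f \<circledast> g) = fps_dilate c f \<circledast> fps_dilate c g"
  by (rule fps_ext)
    (simp add: dilate_nth fsh_nth sh_smul_left sh_smul_right smul_smul smul_sum flip: power_add)

lemma dilate_1: "fps_dilate 1 f = f"
  by (rule fps_ext) (simp add: dilate_nth)

lemma dilate_one: "fps_dilate c 1 = 1"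
  by (rule fps_ext) (simp add: dilate_nth)

end

section \<open>Products and exponentials as solutions of one differential equation\<close>

locale generic_shuffle_algebra = shuffle_algebra q for q :: "'a::field_char_0" +
  assumes not_root: "k \<ge> 1 \<Longrightarrow> q ^ k \<noteq> 1"
begin

lemma power_minus_inverse_nonzero:
  assumes "n \<ge> 1"
  shows "q ^ n - inverse q ^ n \<noteq> 0"
proof
  assume "q ^ n - inverse q ^ n = 0"
  then have "q ^ n = inverse (q ^ n)" by (simp add: power_inverse)
  moreover have "q ^ n * inverse (q ^ n) = 1" by simp
  ultimately have "q ^ n * q ^ n = 1" by simp
  then show False using not_root[of "n + n"] assms by (simp add: power_add)
qed

lemma q_minus_inverse_nonzero: "q - inverse q \<noteq> 0"
  using power_minus_inverse_nonzero[of 1] by simp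

lemma qint_eq: "qint q (int n) = (q ^ n - inverse q ^ n) / (q - inverse q)"
  by (simp add: qint_def power_int_minus power_inverse)

lemma qint_nonzero: "n \<ge> 1 \<Longrightarrow> qint q (int n) \<noteq> 0"
  unfolding qint_eq using power_minus_inverse_nonzero[of n] q_minus_inverse_nonzero by simp

text \<open>The last summand of the recursion is [n] times \<open>catalan_xy q n\<close>. As [n] is
  nonzero, this element is expressed by powers of xy and earlier elements.\<close>

lemma commute_catalan_xy:
  assumes "\<And>j. z \<odot> word [X, Y] ^ j = word [X, Y] ^ j \<odot> z"
  shows "z \<odot> catalan_xy q n = catalan_xy q n \<odot> z"
proof (induction n rule: less_induct)
  case (less n)
  define t where "t = (\<lambda>i. smul (qint q (int i)) (catalan_xy q i \<odot> smul ((- 1) ^ (n - i)) (word [X, Y] ^ (n - i))))"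
  define g where "g = smul (of_nat n * (- 1) ^ n) (word [X, Y] ^ n :: 'a free_alg)"
  show ?case
  proof (cases "n = 0")
    case False
    have "g = - (\<Sum>i\<le>n. t i)"
      unfolding g_def t_def
      by (rule xy_power_recursion) (simp_all add: q_minus_inverse_nonzero del: right_minus_eq)
    also have "(\<Sum>i\<le>n. t i) = (\<Sum>i<n. t i) + smul (qint q (int n)) (catalan_xy q n)"
      by (simp add: t_def flip: lessThan_Suc_atMost)
    finally have *: "smul (qint q (int n)) (catalan_xy q n) = smul (- 1) (g + (\<Sum>i<n. t i))"
      by (simp add: smul_minus_scalar)
    have g: "z \<odot> g = g \<odot> z" by (simp add: g_def sh_smul_left sh_smul_right assms)
    have "z \<odot> t i = t i \<odot> z" if "i < n" for i
      using less.IH[OF that] by (simp add: t_def sh_smul_left sh_smul_right) (metis assms sh_assoc)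
    then have t: "z \<odot> (\<Sum>i<n. t i) = (\<Sum>i<n. t i) \<odot> z"
      by (simp add: sh_sum_left sh_sum_right)
    have "z \<odot> smul (qint q (int n)) (catalan_xy q n) = smul (qint q (int n)) (catalan_xy q n) \<odot> z"
      unfolding * sh_smul_left sh_smul_right sh_add_left sh_add_right g t ..
    then have "smul (qint q (int n)) (z \<odot> catalan_xy q n) = smul (qint q (int n)) (catalan_xy q n \<odot> z)"
      by (simp add: sh_smul_left sh_smul_right)
    then show ?thesis
      by (rule smul_cancel) (use False in \<open>simp add: qint_nonzero\<close>)
  qed simp
qed

text \<open>\<open>commute_catalan_xy\<close> applies twice: the powers of xy commute with each
  other, hence with all \<open>catalan_xy q i\<close>, hence these among themselves.\<close>

lemma catalan_xy_commute: "catalan_xy q i \<odot> catalan_xy q j = catalan_xy q j \<odot> catalan_xy q i"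
  by (intro commute_catalan_xy commute_catalan_xy[symmetric] shuffle_xy_power_commute) simp

definition catalan_series :: "(nat \<Rightarrow> 'a) \<Rightarrow> 'a free_alg fps" where
  "catalan_series \<beta> = Abs_fps (\<lambda>n. smul (\<beta> n) (catalan_xy q n))"

lemma catalan_series_nth: "fps_nth (catalan_series \<beta>) n = smul (\<beta> n) (catalan_xy q n)"
  by (simp add: catalan_series_def)

lemma catalan_series_nth_0 [simp]: "fps_nth (catalan_series \<beta>) 0 = 0"
  by (simp add: catalan_series_nth)

text \<open>The scalars \<open>\<beta>\<close> record the logarithmic derivative, which always
  combines the same commuting elements \<open>catalan_xy q n\<close>. Products add these scalars and
  dilations rescale them.\<close>

definition solves :: "(nat \<Rightarrow> 'a) \<Rightarrow> 'a free_alg fps \<Rightarrow> bool" where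
  "solves \<beta> f \<longleftrightarrow> euler f = catalan_series \<beta> \<circledast> f \<and> fps_nth f 0 = 1"

lemma solves_unique: "solves \<beta> f \<Longrightarrow> solves \<beta> g \<Longrightarrow> f = g"
  unfolding solves_def by (metis ode_unique catalan_series_nth_0)

lemma solves_one: "solves (\<lambda>n. 0) 1"
  by (auto simp: solves_def euler_one catalan_series_def fsh_nth intro: fps_ext)

text \<open>The product rule yields the sum of both logarithmic derivatives once \<open>f\<close> is
  moved past the second one, which \<open>ode_commute\<close> permits.\<close>

lemma solves_fsh:
  assumes "solves \<beta> f" "solves \<beta>' g"
  shows "solves (\<lambda>n. \<beta> n + \<beta>' n) (f \<circledast> g)"
proof -
  have "catalan_xy q j \<odot> fps_nth f i = fps_nth f i \<odot> catalan_xy q j" for i j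
    using assms(1)
    by (intro ode_commute[of f "catalan_series \<beta>"])
      (simp_all add: solves_def catalan_series_nth sh_smul_left sh_smul_right catalan_xy_commute)
  then have comm: "f \<circledast> catalan_series \<beta>' = catalan_series \<beta>' \<circledast> f"
    by (intro fsh_commute) (simp add: catalan_series_nth sh_smul_left sh_smul_right)
  have "euler (f \<circledast> g) = catalan_series \<beta> \<circledast> f \<circledast> g + f \<circledast> catalan_series \<beta>' \<circledast> g"
    using assms by (simp add: solves_def euler_fsh fsh_assoc)
  also have "\<dots> = (catalan_series \<beta> + catalan_series \<beta>') \<circledast> (f \<circledast> g)"
    by (simp add: comm fsh_add_left fsh_assoc)
  also have "catalan_series \<beta> + catalan_series \<beta>' = catalan_series (\<lambda>n. \<beta> n + \<beta>' n)"
    by (rule fps_ext) (simp add: catalan_series_nth smul_add_scalar)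
  finally show ?thesis using assms by (simp add: solves_def fsh_nth)
qed

lemma solves_prod:
  assumes "\<And>i. i \<in> set is \<Longrightarrow> solves (\<beta> i) (h i)"
  shows "solves (\<lambda>n. \<Sum>i\<leftarrow>is. \<beta> i n) (fps_shuffle_prod q (map h is))"
  using assms by (induction "is") (simp_all add: solves_one solves_fsh)

lemma solves_dilate:
  assumes "solves \<beta> f"
  shows "solves (\<lambda>n. c ^ n * \<beta> n) (fps_dilate c f)"
proof -
  have "fps_dilate c (catalan_series \<beta>) = catalan_series (\<lambda>n. c ^ n * \<beta> n)"
    by (rule fps_ext) (simp add: dilate_nth catalan_series_nth smul_smul)
  then show ?thesis
    using assms by (simp add: solves_def dilate_euler dilate_fsh dilate_nth)
qed

lemma solves_exp: "solves (\<lambda>n. of_nat n * \<beta> n) (fps_shuffle_exp q (catalan_series \<beta>))"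
proof -
  have euler: "euler (catalan_series \<beta>) = catalan_series (\<lambda>n. of_nat n * \<beta> n)"
    by (rule fps_ext) (simp add: euler_nth catalan_series_nth smul_smul)
  have "catalan_series \<beta> \<circledast> euler (catalan_series \<beta>) = euler (catalan_series \<beta>) \<circledast> catalan_series \<beta>"
    unfolding euler
    by (rule fsh_commute)
      (simp add: catalan_series_nth sh_smul_left sh_smul_right catalan_xy_commute smul_smul mult.commute)
  then show ?thesis
    using euler_exp[of "catalan_series \<beta>"] by (simp add: solves_def exp_nth_0 euler)
qed

lemma solves_Gt: "solves (\<lambda>n. - qint q (int n)) (fps_dilate (- 1) Gt)"
proof -
  have "fps_nth (euler (fps_dilate (- 1) Gt)) n =
      fps_nth (catalan_series (\<lambda>n. - qint q (int n)) \<circledast> fps_dilate (- 1) Gt) n" for n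
    using xy_power_recursion[of q n] q_minus_inverse_nonzero
    by (simp add: euler_nth dilate_nth Gt_def smul_smul fsh_nth catalan_series_nth sh_smul_left
        del: right_minus_eq) (simp add: smul_minus_scalar sum_negf)
  then show ?thesis
    unfolding solves_def by (auto intro: fps_ext simp: dilate_nth Gt_def)
qed

lemma catalan_log_eq: "catalan_log q m = catalan_series (\<lambda>n. qint q (int (m * n)) / of_nat n)"
  by (rule fps_ext) (simp add: catalan_log_def catalan_series_nth catalan_xy_def)

lemma minus_catalan_series: "- catalan_series \<beta> = catalan_series (\<lambda>n. - \<beta> n)"
  by (rule fps_ext) (simp add: catalan_series_nth smul_minus_scalar)

text \<open>\<open>Dt q\<close> is a definite description, so an inverse is exhibited first.
  Solutions with opposite \<open>\<beta>\<close> multiply to a solution for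
  \<open>\<beta> = 0\<close>, which is 1 by uniqueness.\<close>

lemma solves_Dt: "solves (\<lambda>n. qint q (int n)) (fps_dilate (- 1) (Dt q))"
proof -
  let ?\<gamma> = "fps_dilate (- 1) Gt"
  \<comment> \<open>The right side of the second identity for m = 1 supplies the inverse of
    Gt(-t).\<close>
  define \<eta> where "\<eta> = fps_shuffle_exp q (catalan_log q 1)"
  have \<eta>: "solves (\<lambda>n. qint q (int n)) \<eta>"
  proof -
    have "of_nat n * (qint q (int (1 * n)) / of_nat n) = qint q (int n)" for n
      by (cases "n = 0") (simp_all add: qint_def)
    then show ?thesis
      using solves_exp[of "\<lambda>n. qint q (int (1 * n)) / of_nat n"] unfolding \<eta>_def catalan_log_eq by simp
  qed
  have "?\<gamma> \<circledast> \<eta> = 1" "\<eta> \<circledast> ?\<gamma> = 1"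
    using solves_unique[OF _ solves_one] solves_fsh[OF solves_Gt \<eta>] solves_fsh[OF \<eta> solves_Gt]
    by simp_all
  then have inv: "Gt \<circledast> fps_dilate (- 1) \<eta> = 1" "fps_dilate (- 1) \<eta> \<circledast> Gt = 1"
    using dilate_fsh[of "- 1" ?\<gamma> \<eta>] dilate_fsh[of "- 1" \<eta> ?\<gamma>]
    by (simp_all add: dilate_dilate dilate_one dilate_1)
  have "Dt q = fps_dilate (- 1) \<eta>"
    unfolding Dt_def fps_shuffle_inverse_def
  proof (rule the_equality)
    fix g assume "Gt \<circledast> g = 1 \<and> g \<circledast> Gt = 1"
    then show "g = fps_dilate (- 1) \<eta>" by (metis inv(2) fsh_assoc fsh_one_left fsh_one_right)
  qed (simp add: inv)
  then show ?thesis using \<eta> by (simp add: dilate_dilate dilate_1)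
qed

text \<open>Multiplied by q^n - q^(-n) the sum telescopes: with \<open>T\<close> as below, the i-th
  summand is the difference of the powers of q with exponents n(m-2i) and n(m-2(i+1)).\<close>

lemma sum_powers_qint:
  "(\<Sum>i\<leftarrow>[0..<m]. (q powi (int m - 1 - 2 * int i)) ^ n * qint q (int n)) = qint q (int (m * n))"
proof -
  define T where "T i = q powi (int n * (int m - 2 * int i))" for i
  have "(q powi (int m - 1 - 2 * int i)) ^ n * (q ^ n - inverse q ^ n) = T i - T (Suc i)" for i
  proof -
    have "(q powi (int m - 1 - 2 * int i)) ^ n = q powi (int n * (int m - 1 - 2 * int i))"
      by (metis mult.commute power_int_mult power_int_of_nat)
    moreover have "q powi k * q ^ n = q powi (k + int n)"
      "q powi k * inverse q ^ n = q powi (k - int n)" for k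
      using power_int_add[of q k "- int n"]
      by (simp_all add: power_int_add power_int_minus power_inverse)
    ultimately show ?thesis
      unfolding T_def by (simp add: right_diff_distrib) (simp add: algebra_simps)
  qed
  then have "(\<Sum>i<m. (q powi (int m - 1 - 2 * int i)) ^ n * (q ^ n - inverse q ^ n)) = T 0 - T m"
    using sum_lessThan_telescope'[of T m] by simp
  also have "T 0 - T m = q ^ (m * n) - inverse q ^ (m * n)"
    unfolding T_def by (simp add: power_int_minus power_inverse mult.commute flip: of_nat_mult)
  finally show ?thesis
    unfolding qint_eq times_divide_eq_right
    by (simp add: interv_sum_list_conv_sum_set_nat atLeast0LessThan flip: sum_divide_distrib)
qed

text \<open>Both sides have the logarithmic derivative with scalars s [mn]: the product by
  \<open>sum_powers_qint\<close>, the exponential because t d/dt cancels the denominators n. The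
  sign \<open>s\<close> will be -1 for \<open>Gt\<close> and 1 for \<open>Dt q\<close>.\<close>

lemma exp_catalan_log:
  assumes "solves (\<lambda>n. s * qint q (int n)) (fps_dilate (- 1) f)"
  shows "fps_shuffle_prod q (map (\<lambda>i. fps_dilate (- (q powi (int m - 1 - 2 * int i))) f) [0..<m]) =
    fps_shuffle_exp q (catalan_series (\<lambda>n. s * (qint q (int (m * n)) / of_nat n)))"
proof (rule solves_unique)
  have "solves (\<lambda>n. \<Sum>i\<leftarrow>[0..<m]. (q powi (int m - 1 - 2 * int i)) ^ n * (s * qint q (int n)))
     (fps_shuffle_prod q
       (map (\<lambda>i. fps_dilate (q powi (int m - 1 - 2 * int i)) (fps_dilate (- 1) f)) [0..<m]))"
    by (rule solves_prod) (rule solves_dilate[OF assms])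
  also have "(\<lambda>n. \<Sum>i\<leftarrow>[0..<m]. (q powi (int m - 1 - 2 * int i)) ^ n * (s * qint q (int n))) =
    (\<lambda>n. s * qint q (int (m * n)))"
    by (simp add: sum_list_const_mult mult.left_commute[of _ s] sum_powers_qint del: of_nat_mult)
  finally show "solves (\<lambda>n. s * qint q (int (m * n))) (fps_shuffle_prod q
     (map (\<lambda>i. fps_dilate (- (q powi (int m - 1 - 2 * int i))) f) [0..<m]))"
    by (simp add: dilate_dilate)
  \<comment> \<open>At n = 0 both sides are 0, as [0] = 0.\<close>
  have "of_nat n * (s * (qint q (int (m * n)) / of_nat n)) = s * qint q (int (m * n))" for n
    by (cases "n = 0") (simp_all add: qint_def)
  then show "solves (\<lambda>n. s * qint q (int (m * n)))
     (fps_shuffle_exp q (catalan_series (\<lambda>n. s * (qint q (int (m * n)) / of_nat n))))"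
    using solves_exp[of "\<lambda>n. s * (qint q (int (m * n)) / of_nat n)"] by simp
qed

end

theorem theorem2p24:
  fixes q :: "'a::field_char_0" and m :: nat
  assumes "q \<noteq> 0"
    and "\<And>k::nat. k \<ge> 1 \<Longrightarrow> q ^ k \<noteq> 1"
    and "m \<ge> 1"
  shows "fps_shuffle_prod q
           (map (\<lambda>i. fps_dilate (- (q powi (int m - 1 - 2 * int i))) Gt) [0..<m])
         = fps_shuffle_exp q (- catalan_log q m) \<and>
         fps_shuffle_prod q
           (map (\<lambda>i. fps_dilate (- (q powi (int m - 1 - 2 * int i))) (Dt q)) [0..<m])
         = fps_shuffle_exp q (catalan_log q m)"
proof -
  interpret generic_shuffle_algebra q
    by unfold_locales (use assms in auto)
  show ?thesis
    using exp_catalan_log[of "- 1" Gt m] exp_catalan_log[of 1 "Dt q" m] solves_Gt solves_Dt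
    by (simp add: catalan_log_eq minus_catalan_series)
qed

end
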